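(* Let $n\ge 1$ be an integer and let $k=(k_1,\dots,k_n)\in[0,1]^n$ be a non-increasing threshold vector with last entry zero: $k_1\ge k_2\ge\cdots\ge k_{n-1}\ge k_n=0$. Let $PW(n,r)$, $PFP(n,r)$, $PFN(n,r)$ and $PC(n,r)$ be the round-$r$ win, false positive, false negative and continuation probabilities of the pre-commitment rule with thresholds $k$ applied to $n$ i.i.d. uniform draws on $[0,1]$ (with $PC(n,0)=1$). Define, for integers $1\le i,j\le r\le n-1$, $$f(i,j,n,r)=\begin{cases} n-r+i & \text{if } i=j,\\ 1 & \text{if } i<j,\\ 0 & \text{if } i>j,\end{cases}\qquad g(i,n,r)=\frac{n-r}{(n-r+i-1)(n-r+i)}.$$ Then $\sum_{j=1}^{r} f(i,j,n,r)=n$ for all $1\le i\le r\le n-1$, and the following hold. 1. For $1\le r\le n$, $\displaystyle PFN(n,r)=\frac{k_r^{\,n}}{n}$. 2. For $1\le r\le n$, $\displaystyle PW(n,r)=\frac{PC(n,r-1)}{n-r+1}-PFN(n,r)$. 3. For $1\le r\le n$, $PFP(n,r)=\bigl(PC(n,r-1)-(PW(n,r)+PFN(n,r))\bigr)-PC(n,r)$. 4. For $1\le r\le n-1$, $\displaystyle PC(n,r)=\prod_{j=1}^{r}k_j-\sum_{i=1}^{r}\Bigl(g(i,n,r)\prod_{j=1}^{r}k_j^{\,f(i,j,n,r)}\Bigr)$. 5. For $1\le r\le n$, $$PW(n,r)=\frac{1}{n-r+1}\Biggl(\prod_{j=1}^{r-1}k_j-\sum_{i=1}^{r-1}g(i,n,r-1)\prod_{j=1}^{r-1}k_j^{\,f(i,j,n,r-1)}\Biggr)-\frac{k_r^{\,n}}{n}.$$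 6. The overall probability that the pre-commitment rule with thresholds $k$ stops at the overall maximum is $PW(n)=\sum_{r=1}^{n}PW(n,r)$.
   Context: Let $a_1,\dots,a_n$ be i.i.d. uniform random variables on $[0,1]$, observed in sequence. Given a threshold vector $k=(k_1,\dots,k_n)$ with $k_n=0$ (so the last draw is always accepted), the pre-commitment rule stops at the first round $r$ with $a_r\ge k_r$ and accepts $a_r$. No check of whether $a_r$ is a running maximum is made. The outcome of the game is classified round by round. The game is said to have continued through round $r$ if for every $j\le r$ the draw $a_j$ was not accepted and is not the overall maximum; that is, $a_j<k_j$ and $a_j\ne\max(a_1,\dots,a_n)$ for all $1\le j\le r$. $PC(n,r)$ is the probability of this event, and $PC(n,0)=1$. (Since $k_n=0$, $PC(n,n)=0$.) For $1\le r\le n$, the following are probabilities of joint events (not conditional probabilities): - $PW(n,r)$ (true positive, win): the game has continued through round $r-1$, and $a_r\ge k_r$ and $a_r=\max(a_1,\dots,a_n)$. - $PFP(n,r)$ (false positive): the game has continued through round $r-1$, and $a_r\ge k_r$ and $a_r\ne\max(a_1,\dots,a_n)$. - $PFN(n,r)$ (false negative): the game has continued through round $r-1$, and $a_r<k_r$ and $a_r=\max(a_1,\dots,a_n)$. Conventions: empty products equal $1$, empty sums equal $0$, and $x^0=1$ for all $x$, including $x=0$. *)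

theory Defs
  imports "HOL-Probability.Probability"
begin

text \<open>
  Rounds are numbered from 1 to \<open>n\<close>. A sequence of draws is a function \<open>x\<close> on the naturals of which
  only the values \<open>x 1, \<dots>, x n\<close> matter, and likewise for the threshold vector \<open>k\<close>. The predicates
  concern one realised sequence of draws; the probabilities further down are taken with respect to a
  family \<open>a\<close> of random variables on a probability space \<open>M\<close>.
\<close>

definition overall_max :: "nat \<Rightarrow> (nat \<Rightarrow> real) \<Rightarrow> real" where
  "overall_max n x = Max (x ` {1..n})"

definition continued :: "nat \<Rightarrow> (nat \<Rightarrow> real) \<Rightarrow> (nat \<Rightarrow> real) \<Rightarrow> nat \<Rightarrow> bool" where
  "continued n k x r \<longleftrightarrow> (\<forall>j\<in>{1..r}. x j < k j \<and> x j \<noteq> overall_max n x)"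

definition stops_at :: "(nat \<Rightarrow> real) \<Rightarrow> (nat \<Rightarrow> real) \<Rightarrow> nat \<Rightarrow> bool" where
  "stops_at k x r \<longleftrightarrow> x r \<ge> k r \<and> (\<forall>j\<in>{1..<r}. \<not> x j \<ge> k j)"

definition PC :: "'a measure \<Rightarrow> (nat \<Rightarrow> 'a \<Rightarrow> real) \<Rightarrow> (nat \<Rightarrow> real) \<Rightarrow> nat \<Rightarrow> nat \<Rightarrow> real" where
  "PC M a k n r = measure M {\<omega> \<in> space M. continued n k (\<lambda>i. a i \<omega>) r}"

definition PW :: "'a measure \<Rightarrow> (nat \<Rightarrow> 'a \<Rightarrow> real) \<Rightarrow> (nat \<Rightarrow> real) \<Rightarrow> nat \<Rightarrow> nat \<Rightarrow> real" where
  "PW M a k n r = measure M {\<omega> \<in> space M. continued n k (\<lambda>i. a i \<omega>) (r - 1) \<and>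
     a r \<omega> \<ge> k r \<and> a r \<omega> = overall_max n (\<lambda>i. a i \<omega>)}"

definition PFP :: "'a measure \<Rightarrow> (nat \<Rightarrow> 'a \<Rightarrow> real) \<Rightarrow> (nat \<Rightarrow> real) \<Rightarrow> nat \<Rightarrow> nat \<Rightarrow> real" where
  "PFP M a k n r = measure M {\<omega> \<in> space M. continued n k (\<lambda>i. a i \<omega>) (r - 1) \<and>
     a r \<omega> \<ge> k r \<and> a r \<omega> \<noteq> overall_max n (\<lambda>i. a i \<omega>)}"

definition PFN :: "'a measure \<Rightarrow> (nat \<Rightarrow> 'a \<Rightarrow> real) \<Rightarrow> (nat \<Rightarrow> real) \<Rightarrow> nat \<Rightarrow> nat \<Rightarrow> real" where
  "PFN M a k n r = measure M {\<omega> \<in> space M. continued n k (\<lambda>i. a i \<omega>) (r - 1) \<and>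
     a r \<omega> < k r \<and> a r \<omega> = overall_max n (\<lambda>i. a i \<omega>)}"

text \<open>
  The overall winning probability is defined through the stopping rule itself and not through
  \<^const>\<open>continued\<close>: earlier rejected draws are allowed here to tie with the maximum.
\<close>

definition PW_total :: "'a measure \<Rightarrow> (nat \<Rightarrow> 'a \<Rightarrow> real) \<Rightarrow> (nat \<Rightarrow> real) \<Rightarrow> nat \<Rightarrow> real" where
  "PW_total M a k n = measure M {\<omega> \<in> space M. \<exists>r\<in>{1..n}. stops_at k (\<lambda>i. a i \<omega>) r \<and>
     a r \<omega> = overall_max n (\<lambda>i. a i \<omega>)}"

lemma (in prob_space) PC_0: "PC M a k n 0 = 1"
  by (simp add: PC_def continued_def prob_space)

text \<open>
  The exponents \<open>f(i,j,n,r)\<close> and coefficients \<open>g(i,n,r)\<close> are meant for \<open>1 \<le> i, j \<le> r \<le> n - 1\<close>.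
  In this range the subtraction of naturals in \<open>f\<close> does not truncate and the denominator in \<open>g\<close> is
  positive. A zero exponent always gives the factor 1, as \<open>0 ^ 0 = 1\<close>.
\<close>

definition fexp :: "nat \<Rightarrow> nat \<Rightarrow> nat \<Rightarrow> nat \<Rightarrow> nat" where
  "fexp i j n r = (if i = j then n - r + i else if i < j then 1 else 0)"

definition gcoef :: "nat \<Rightarrow> nat \<Rightarrow> nat \<Rightarrow> real" where
  "gcoef i n r = (real n - real r) /
     ((real n - real r + real i - 1) * (real n - real r + real i))"

end

theory Submission
  imports Defs
begin

text \<open>
  Everything reduces to one family of events. Given caps \<open>c 1, \<dots>, c n\<close> in \<open>[0,1]\<close>, consider the event
  that each draw lies below its cap and draw \<open>m\<close> strictly exceeds all the others. Conditioning on the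
  value \<open>x\<close> of draw \<open>m\<close>, the remaining draws are independent and draw \<open>j\<close> must fall below both \<open>x\<close> and
  \<open>c j\<close>, so the probability is the integral of \<open>\<Prod>j\<noteq>m. min x (c j)\<close> over \<open>[0, c m]\<close>
  (\<open>prob_strict_max_below\<close>).

  With all caps equal to \<open>t\<close> this is \<open>t ^ n / n\<close>. For \<open>t = 1\<close> the \<open>n\<close> disjoint events thus have total
  probability \<open>1\<close>; hence almost surely one draw strictly exceeds all the others and ties can be
  ignored from then on (\<open>AE_strict_max\<close>). A false negative in round \<open>r\<close> is the case \<open>t = k r\<close>: as the
  thresholds do not increase, a maximum below \<open>k r\<close> forces every earlier draw below its own threshold.

  The game continues through round \<open>r\<close> iff the first \<open>r\<close> draws are below their thresholds and the
  maximum occurs at one of the \<open>n - r\<close> later positions \<open>m\<close>. All these positions contribute the same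
  integral of \<open>x ^ (n - r - 1) * (\<Prod>j\<le>r. min x (k j))\<close> over \<open>[0,1]\<close>. Taking \<open>r - 1\<close> for \<open>r\<close> and \<open>m = r\<close>
  gives exactly the probability that the game reaches round \<open>r\<close> and the maximum is there, so this
  probability is a share \<open>1 / (n - r + 1)\<close> of \<open>PC(n, r - 1)\<close>; it splits into a win and a false
  negative.

  The integral is evaluated by removing the smallest threshold: below \<open>k (r + 1)\<close> every minimum is
  \<open>x\<close>, and above it the last minimum is the constant \<open>k (r + 1)\<close>. This yields a one-step recursion
  (\<open>integral_prod_min_step\<close>), in which the correction term introduced for the \<open>i\<close>-th threshold,
  multiplied by \<open>n - r\<close> and by the later thresholds, is the summand of the closed form with
  coefficient \<open>g(i,n,r)\<close>.
\<close>

section \<open>Exponents and integrals of products of minima\<close>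

lemma sum_fexp:
  assumes "i \<in> {1..r}" "r \<le> n"
  shows "(\<Sum>j=1..r. fexp i j n r) = n"
proof -
  have split: "{1..r} = {1..<i} \<union> (insert i {i<..r})" using assms by auto
  have "(\<Sum>j\<in>{1..<i}. fexp i j n r) = 0" "(\<Sum>j\<in>{i<..r}. fexp i j n r) = (\<Sum>j\<in>{i<..r}. 1)"
    by (auto intro!: sum.neutral sum.cong simp: fexp_def simp del: sum_constant)
  then show ?thesis
    unfolding split using assms by (subst sum.union_disjoint) (auto simp: fexp_def)
qed

lemma integral_monomial:
  fixes c :: real
  assumes "0 \<le> c"
  shows "integral {0..c} (\<lambda>x. x ^ p) = c ^ Suc p / real (Suc p)"
proof -
  have "((\<lambda>x. x ^ Suc p / real (Suc p)) has_real_derivative x ^ p) (at x within S)" for x S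
    using DERIV_cdivide[OF DERIV_pow[of "Suc p" x S], of "real (Suc p)"] by simp
  then have "((\<lambda>x. x ^ p) has_integral c ^ Suc p / real (Suc p) - 0 ^ Suc p / real (Suc p)) {0..c}"
    using assms
    by (intro fundamental_theorem_of_calculus)
      (auto simp: has_real_derivative_iff_has_vector_derivative[symmetric])
  then show ?thesis by (simp add: integral_unique)
qed

text \<open>
  Split both integrals at the smallest threshold \<open>k (r + 1)\<close>. On the lower part both integrands are
  pure powers of \<open>x\<close>; on the upper part the last minimum is constant, so the integrand on the left is
  \<open>k (r + 1)\<close> times the one on the right.
\<close>
lemma integral_prod_min_step:
  fixes k :: "nat \<Rightarrow> real"
  assumes range: "\<And>j. j \<in> {1..Suc r} \<Longrightarrow> k j \<in> {0..1}"
    and anti: "antimono_on {1..Suc r} k"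
  shows "integral {0..1} (\<lambda>x. x ^ p * (\<Prod>j=1..Suc r. min x (k j))) =
    k (Suc r) * integral {0..1} (\<lambda>x. x ^ p * (\<Prod>j=1..r. min x (k j)))
      - k (Suc r) ^ (p + r + 2) / (real (p + r + 1) * real (p + r + 2))"
proof -
  let ?t = "k (Suc r)"
  let ?P = "\<lambda>r x. x ^ p * (\<Prod>j=1..r. min x (k j))"
  have t: "0 \<le> ?t" "?t \<le> 1" using range[of "Suc r"] by auto
  have le: "?t \<le> k j" if "j \<in> {1..r}" for j
    using anti that by (auto simp: monotone_on_def)
  have cont: "continuous_on A (?P s)" for A s
    by (intro continuous_intros)
  have int: "?P s integrable_on {u..v}" for s u v
    by (intro integrable_continuous_real cont)
  have split: "integral {0..1} (?P s) = integral {0..?t} (?P s) + integral {?t..1} (?P s)" for s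
    using Henstock_Kurzweil_Integration.integral_combine[OF t int[of s 0 1]] by simp
  have low: "?P s x = x ^ (p + s)" if "x \<in> {0..?t}" "s \<le> Suc r" for s x
  proof -
    have "min x (k j) = x" if "j \<in> {1..s}" for j
      using le[of j] that \<open>s \<le> Suc r\<close> \<open>x \<in> _\<close> by (cases "j = Suc r") auto
    then show ?thesis by (simp add: power_add)
  qed
  have low_int: "integral {0..?t} (?P s) = ?t ^ Suc (p + s) / real (Suc (p + s))" if "s \<le> Suc r" for s
    using integral_cong[of "{0..?t}" "?P s" "\<lambda>x. x ^ (p + s)"] low that
      integral_monomial[OF t(1), of "p + s"] by simp
  have "integral {?t..1} (?P (Suc r)) = integral {?t..1} (\<lambda>x. ?t * ?P r x)"
    by (intro integral_cong) (simp add: min_def)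
  also have "\<dots> = ?t * integral {?t..1} (?P r)" by simp
  finally have high: "integral {?t..1} (?P (Suc r)) = ?t * integral {?t..1} (?P r)" .
  have "integral {0..1} (?P (Suc r)) = ?t ^ Suc (p + Suc r) / real (Suc (p + Suc r))
     + ?t * (integral {0..1} (?P r) - ?t ^ Suc (p + r) / real (Suc (p + r)))"
    using split[of "Suc r"] split[of r] high low_int[of r] low_int[of "Suc r"] by simp
  also have "\<dots> = ?t * integral {0..1} (?P r)
      - ?t ^ (p + r + 2) / (real (p + r + 1) * real (p + r + 2))"
  proof -
    have "t * t * A / (Q + 1) + t * (J - t * A / Q) = t * J - t * t * A / (Q * (Q + 1))"
      if "Q > 0" for t A J Q :: real
    proof -
      have "Q \<noteq> 0" "Q + 1 \<noteq> 0" using that by auto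
      then show ?thesis by (simp add: divide_simps) (simp add: algebra_simps)
    qed
    from this[of "real (p + r + 1)" ?t "?t ^ (p + r)"] show ?thesis
      by (simp add: algebra_simps)
  qed
  finally show ?thesis .
qed

text \<open>
  With \<open>n = p + 1 + r\<close>, that is, with \<open>n - r\<close> held fixed, neither \<open>g(i,n,r)\<close> nor \<open>f(i,j,n,r)\<close> depends
  on \<open>r\<close>. Raising \<open>r\<close> therefore multiplies all old summands by \<open>k (r + 1)\<close>, and the correction term
  of the recursion becomes the new summand.
\<close>
lemma integral_prod_min:
  fixes k :: "nat \<Rightarrow> real"
  assumes "\<And>j. j \<in> {1..r} \<Longrightarrow> k j \<in> {0..1}" and "antimono_on {1..r} k"
  shows "real (Suc p) * integral {0..1} (\<lambda>x. x ^ p * (\<Prod>j=1..r. min x (k j))) =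
    (\<Prod>j=1..r. k j) -
    (\<Sum>i=1..r. gcoef i (Suc p + r) r * (\<Prod>j=1..r. k j ^ fexp i j (Suc p + r) r))"
  using assms
proof (induction r)
  case 0
  show ?case using integral_monomial[of 1 p] by simp
next
  case (Suc r)
  have anti: "antimono_on {1..r} k"
    by (rule monotone_on_subset[OF Suc.prems(2)]) auto
  let ?t = "k (Suc r)" and ?N = "Suc p + r" and ?N' = "Suc p + Suc r"
  let ?J = "integral {0..1} (\<lambda>x. x ^ p * (\<Prod>j=1..r. min x (k j)))"
  have f: "fexp i j ?N' (Suc r) = fexp i j ?N r" for i j
    by (simp add: fexp_def)
  have g: "gcoef i ?N' (Suc r) = gcoef i ?N r" for i
    by (simp add: gcoef_def)
  have sum_Suc: "(\<Sum>i=1..Suc r. h i) = (\<Sum>i=1..r. h i) + h (Suc r)" for h :: "nat \<Rightarrow> real"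
    by simp
  have old: "gcoef i ?N' (Suc r) * (\<Prod>j=1..Suc r. k j ^ fexp i j ?N' (Suc r)) =
      ?t * (gcoef i ?N r * (\<Prod>j=1..r. k j ^ fexp i j ?N r))" if "i \<in> {1..r}" for i
    using that unfolding f g by (simp add: fexp_def)
  have "(\<Prod>j=1..r. k j ^ fexp (Suc r) j ?N' (Suc r)) = 1"
    by (intro prod.neutral) (auto simp: fexp_def)
  then have new: "gcoef (Suc r) ?N' (Suc r) * (\<Prod>j=1..Suc r. k j ^ fexp (Suc r) j ?N' (Suc r)) =
      real (Suc p) * (?t ^ (p + r + 2) / (real (p + r + 1) * real (p + r + 2)))"
    by (simp add: gcoef_def fexp_def algebra_simps)
  have "real (Suc p) * integral {0..1} (\<lambda>x. x ^ p * (\<Prod>j=1..Suc r. min x (k j))) =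
      ?t * (real (Suc p) * ?J) - real (Suc p) * (?t ^ (p + r + 2) / (real (p + r + 1) * real (p + r + 2)))"
    by (subst integral_prod_min_step[OF Suc.prems])
      (assumption | simp only: right_diff_distrib mult.left_commute[of "real (Suc p)" ?t])+
  also have "real (Suc p) * ?J = (\<Prod>j=1..r. k j) -
      (\<Sum>i=1..r. gcoef i ?N r * (\<Prod>j=1..r. k j ^ fexp i j ?N r))"
    using Suc.prems(1) anti by (intro Suc.IH) auto
  also have "?t * \<dots> = (\<Prod>j=1..Suc r. k j) -
      (\<Sum>i=1..r. gcoef i ?N' (Suc r) * (\<Prod>j=1..Suc r. k j ^ fexp i j ?N' (Suc r)))"
    unfolding right_diff_distrib sum_distrib_left using old by (simp add: mult.commute)
  also have "\<dots> - real (Suc p) * (?t ^ (p + r + 2) / (real (p + r + 1) * real (p + r + 2))) =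
      (\<Prod>j=1..Suc r. k j) -
      (\<Sum>i=1..Suc r. gcoef i ?N' (Suc r) * (\<Prod>j=1..Suc r. k j ^ fexp i j ?N' (Suc r)))"
    unfolding new[symmetric] sum_Suc by (simp only: diff_diff_eq)
  finally show ?case .
qed

section \<open>Almost sure uniqueness of the maximum\<close>

text \<open>
  For negative \<open>t\<close> the identity survives because \<^const>\<open>ennreal\<close> sends negative numbers to \<open>0\<close>;
  this saves a case distinction under the integral below.
\<close>
lemma emeasure_uniform_lessThan:
  assumes "t \<le> (1::real)"
  shows "emeasure (uniform_measure lborel {0..1}) {..<t} = ennreal t"
proof -
  have "{0..1} \<inter> {..<t} = {0..<t}" using assms by auto
  then show ?thesis by (cases "0 \<le> t") (simp_all add: ennreal_neg divide_ennreal_def)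
qed

locale uniform_draws = prob_space M for M :: "'a measure" +
  fixes a :: "nat \<Rightarrow> 'a \<Rightarrow> real" and n :: nat
  assumes indep: "indep_vars (\<lambda>_. borel) a {1..n}"
    and uniform: "\<And>i. i \<in> {1..n} \<Longrightarrow> distr M borel (a i) = uniform_measure lborel {0..1}"
    and n_pos: "n \<ge> 1"
begin

definition strict_max_below :: "(nat \<Rightarrow> real) \<Rightarrow> nat \<Rightarrow> 'a set" where
  "strict_max_below c m = {\<omega> \<in> space M. (\<forall>j\<in>{1..n}. a j \<omega> < c j) \<and> (\<forall>j\<in>{1..n} - {m}. a j \<omega> < a m \<omega>)}"

lemma measurable_draw [measurable]: "i \<in> {1..n} \<Longrightarrow> a i \<in> borel_measurable M"
  using indep unfolding indep_vars_def by auto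

lemma sets_strict_max_below [measurable]:
  assumes "m \<in> {1..n}"
  shows "strict_max_below c m \<in> events"
  using assms unfolding strict_max_below_def by measurable

lemma distr_draws:
  "distr M (\<Pi>\<^sub>M i\<in>{1..n}. borel) (\<lambda>\<omega>. \<lambda>i\<in>{1..n}. a i \<omega>) = (\<Pi>\<^sub>M i\<in>{1..n}. uniform_measure lborel {0..1})"
proof -
  have "distr M (\<Pi>\<^sub>M i\<in>{1..n}. borel) (\<lambda>\<omega>. \<lambda>i\<in>{1..n}. a i \<omega>) = (\<Pi>\<^sub>M i\<in>{1..n}. distr M borel (a i))"
    using indep n_pos by (subst indep_vars_iff_distr_eq_PiM'[symmetric]) auto
  also have "\<dots> = (\<Pi>\<^sub>M i\<in>{1..n}. uniform_measure lborel {0..1})"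
    by (intro PiM_cong refl uniform)
  finally show ?thesis .
qed

text \<open>
  The joint law of the draws is a product measure, so Fubini's theorem allows integrating over draw
  \<open>m\<close> last. For a fixed value \<open>y\<close> of that draw the section of the event is a box with sides
  below \<open>min y (c j)\<close>.
\<close>
lemma prob_strict_max_below:
  assumes m: "m \<in> {1..n}" and c: "\<And>j. j \<in> {1..n} \<Longrightarrow> c j \<in> {0..1}"
  shows "prob (strict_max_below c m) = integral {0..c m} (\<lambda>x. \<Prod>j\<in>{1..n} - {m}. min x (c j))"
proof -
  let ?U = "uniform_measure lborel {0..1::real}"
  let ?I = "{1..n} - {m}"
  let ?P = "\<lambda>x. \<Prod>j\<in>?I. min x (c j)"
  define S where "S = {x \<in> space (\<Pi>\<^sub>M i\<in>{1..n}. borel). (\<forall>j\<in>{1..n}. x j < c j) \<and> (\<forall>j\<in>?I. x j < x m)}"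
  have I: "insert m ?I = {1..n}" using m by auto
  have S [measurable]: "S \<in> sets (\<Pi>\<^sub>M i\<in>{1..n}. borel)"
    unfolding S_def using m by measurable
  have sets_eq: "sets (\<Pi>\<^sub>M i\<in>{1..n}. ?U) = sets (\<Pi>\<^sub>M i\<in>{1..n}. borel)"
    by (intro sets_PiM_cong) auto
  have S' [measurable]: "S \<in> sets (\<Pi>\<^sub>M i\<in>{1..n}. ?U)"
    using S by (simp only: sets_eq)
  have U: "prob_space ?U" by (intro prob_space_uniform_measure) auto
  interpret U: product_prob_space "\<lambda>_::nat. ?U"
    by (rule product_prob_spaceI) (rule U)
  have inner: "(\<integral>\<^sup>+ x. indicator S (x(m := y)) \<partial>(\<Pi>\<^sub>M i\<in>?I. ?U)) =
      indicator {..<c m} y * (\<Prod>j\<in>?I. ennreal (min y (c j)))" for y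
  proof -
    have "(\<integral>\<^sup>+ x. indicator S (x(m := y)) \<partial>(\<Pi>\<^sub>M i\<in>?I. ?U)) =
      (\<integral>\<^sup>+ x. indicator {..<c m} y * indicator (\<Pi>\<^sub>E j\<in>?I. {..<min y (c j)}) x \<partial>(\<Pi>\<^sub>M i\<in>?I. ?U))"
    proof (intro nn_integral_cong)
      fix x assume "x \<in> space (\<Pi>\<^sub>M i\<in>?I. ?U)"
      then have "x \<in> extensional ?I" by (auto simp: space_PiM PiE_def)
      then have "x(m := y) \<in> S \<longleftrightarrow> y < c m \<and> x \<in> (\<Pi>\<^sub>E j\<in>?I. {..<min y (c j)})"
        using m by (auto simp: S_def space_PiM PiE_def extensional_def Pi_def)
      then show "indicator S (x(m := y)) =
          (indicator {..<c m} y * indicator (\<Pi>\<^sub>E j\<in>?I. {..<min y (c j)}) x :: ennreal)"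
        by (auto split: split_indicator)
    qed
    also have "\<dots> = indicator {..<c m} y * emeasure (\<Pi>\<^sub>M i\<in>?I. ?U) (\<Pi>\<^sub>E j\<in>?I. {..<min y (c j)})"
      by (subst nn_integral_cmult_indicator) (auto intro!: sets_PiM_I_finite)
    also have "emeasure (\<Pi>\<^sub>M i\<in>?I. ?U) (\<Pi>\<^sub>E j\<in>?I. {..<min y (c j)}) =
        (\<Prod>j\<in>?I. emeasure ?U {..<min y (c j)})"
      by (intro U.emeasure_PiM) auto
    also have "\<dots> = (\<Prod>j\<in>?I. ennreal (min y (c j)))"
      using c by (intro prod.cong refl emeasure_uniform_lessThan) (auto intro: min.coboundedI2)
    finally show ?thesis .
  qed
  have "emeasure M (strict_max_below c m) =
      emeasure (distr M (\<Pi>\<^sub>M i\<in>{1..n}. borel) (\<lambda>\<omega>. \<lambda>i\<in>{1..n}. a i \<omega>)) S"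
    using m by (subst emeasure_distr)
      (auto simp: S_def strict_max_below_def space_PiM intro!: arg_cong[where f = "emeasure M"])
  also have "\<dots> = (\<integral>\<^sup>+ x. indicator S x \<partial>(\<Pi>\<^sub>M i\<in>insert m ?I. ?U))"
    unfolding distr_draws I by (subst nn_integral_indicator[OF S']) (rule refl)
  also have "\<dots> = (\<integral>\<^sup>+ y. (\<integral>\<^sup>+ x. indicator S (x(m := y)) \<partial>(\<Pi>\<^sub>M i\<in>?I. ?U)) \<partial>?U)"
    using S' by (intro U.product_nn_integral_insert_rev borel_measurable_indicator) (auto simp only: I)
  also have "\<dots> = (\<integral>\<^sup>+ y. indicator {..<c m} y * (\<Prod>j\<in>?I. ennreal (min y (c j))) \<partial>?U)"
    by (simp only: inner)
  also have "\<dots> = (\<integral>\<^sup>+ y\<in>{0..1}. indicator {..<c m} y * (\<Prod>j\<in>?I. ennreal (min y (c j))) \<partial>lborel)"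
    by (subst nn_integral_uniform_measure) (simp_all add: divide_ennreal_def)
  also have "\<dots> = (\<integral>\<^sup>+ y. ennreal (?P y) * indicator {0..c m} y \<partial>lborel)"
  proof (intro nn_integral_cong_AE)
    show "AE y in lborel. indicator {..<c m} y * (\<Prod>j\<in>?I. ennreal (min y (c j))) *
        indicator {0..1} y = ennreal (?P y) * indicator {0..c m} y"
      using AE_lborel_singleton[of "c m"]
    proof eventually_elim
      \<comment> \<open>The event asks for a strict inequality at the cap, the integral includes the end point.\<close>
      fix y assume y: "y \<noteq> c m"
      show "indicator {..<c m} y * (\<Prod>j\<in>?I. ennreal (min y (c j))) *
        indicator {0..1} y = ennreal (?P y) * indicator {0..c m} y"
      proof (cases "y \<in> {0..<c m}")
        case True
        then have "y \<in> {0..1}" using c[OF m] by auto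
        moreover from this have "(\<Prod>j\<in>?I. ennreal (min y (c j))) = ennreal (?P y)"
          using c by (subst prod_ennreal) auto
        ultimately show ?thesis using True by simp
      qed (use y in \<open>auto split: split_indicator\<close>)
    qed
  qed
  also have "\<dots> = ennreal (integral {0..c m} ?P)"
  proof (rule nn_integral_has_integral_lebesgue')
    show "0 \<le> ?P x" if "x \<in> {0..c m}" for x
      using that c by (intro prod_nonneg) auto
    show "(?P has_integral integral {0..c m} ?P) {0..c m}"
      by (intro integrable_integral integrable_continuous_real continuous_intros)
  qed
  finally have "emeasure M (strict_max_below c m) = ennreal (integral {0..c m} ?P)" .
  moreover have "0 \<le> integral {0..c m} ?P"
    using c by (intro integral_nonneg integrable_continuous_real continuous_intros prod_nonneg) auto
  ultimately show ?thesis by (simp add: measure_def)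
qed

lemma prob_strict_max_below_const:
  assumes m: "m \<in> {1..n}" and t: "t \<in> {0..1}"
  shows "prob (strict_max_below (\<lambda>_. t) m) = t ^ n / real n"
proof -
  have n: "Suc (n - 1) = n" using n_pos by simp
  have "prob (strict_max_below (\<lambda>_. t) m) = integral {0..t} (\<lambda>x. \<Prod>j\<in>{1..n} - {m}. min x t)"
    using t by (intro prob_strict_max_below m)
  also have "\<dots> = integral {0..t} (\<lambda>x. x ^ (n - 1))"
    using m by (intro integral_cong) simp
  also have "\<dots> = t ^ n / real n"
    using integral_monomial[of t "n - 1"] t unfolding n by simp
  finally show ?thesis .
qed

lemma disjoint_strict_max_below: "disjoint_family_on (strict_max_below c) {1..n}"
proof (unfold disjoint_family_on_def, intro ballI impI equals0I)
  fix l m \<omega> assume "l \<in> {1..n}" "m \<in> {1..n}" "l \<noteq> m"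
    and "\<omega> \<in> strict_max_below c l \<inter> strict_max_below c m"
  then have "a l \<omega> < a m \<omega>" "a m \<omega> < a l \<omega>"
    by (auto simp: strict_max_below_def)
  then show False by simp
qed

lemma prob_UN_strict_max_below:
  assumes "J \<subseteq> {1..n}"
  shows "prob (\<Union>m\<in>J. strict_max_below c m) = (\<Sum>m\<in>J. prob (strict_max_below c m))"
  using assms disjoint_family_on_mono[OF assms disjoint_strict_max_below]
  by (intro finite_measure_finite_Union) (auto intro: finite_subset)

text \<open>
  Ties are excluded by counting: the \<open>n\<close> disjoint events that a given draw is the strict maximum
  each have probability \<open>1 / n\<close>.
\<close>
lemma AE_strict_max: "AE \<omega> in M. \<exists>m\<in>{1..n}. \<omega> \<in> strict_max_below (\<lambda>_. 1) m"
proof -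
  have "prob (\<Union>m\<in>{1..n}. strict_max_below (\<lambda>_. 1) m) = 1"
    using n_pos by (simp add: prob_UN_strict_max_below prob_strict_max_below_const)
  then show ?thesis by (auto dest: AE_prob_1)
qed

text \<open>
  The three equivalences below hold for every outcome with a strict maximum. They turn each
  event of the game into a condition on the position \<open>m\<close> of the maximum and on caps.
\<close>
lemma in_strict_max_below_iff:
  assumes "\<omega> \<in> strict_max_below d m" "m \<in> {1..n}" "l \<in> {1..n}"
  shows "\<omega> \<in> strict_max_below c l \<longleftrightarrow> l = m \<and> (\<forall>j\<in>{1..n}. a j \<omega> < c j)"
proof (cases "l = m")
  case True
  then show ?thesis using assms by (auto simp: strict_max_below_def)
next
  case False
  then have "a l \<omega> < a m \<omega>" using assms by (auto simp: strict_max_below_def)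
  moreover have "a m \<omega> < a l \<omega>" if "\<omega> \<in> strict_max_below c l"
    using that False assms by (auto simp: strict_max_below_def)
  ultimately show ?thesis using False by (meson less_asym)
qed

lemma eq_overall_max_iff:
  assumes "\<omega> \<in> strict_max_below d m" "m \<in> {1..n}" "j \<in> {1..n}"
  shows "a j \<omega> = overall_max n (\<lambda>i. a i \<omega>) \<longleftrightarrow> j = m"
proof -
  have "overall_max n (\<lambda>i. a i \<omega>) = a m \<omega>"
    unfolding overall_max_def using assms(1,2)
    by (intro Max_eqI) (auto simp: strict_max_below_def intro: less_imp_le)
  moreover have "a j \<omega> < a m \<omega>" if "j \<noteq> m"
    using assms that by (auto simp: strict_max_below_def)
  ultimately show ?thesis by (metis less_irrefl)
qed

lemma continued_iff:
  assumes "\<omega> \<in> strict_max_below d m" "m \<in> {1..n}" "r \<le> n"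
  shows "continued n k (\<lambda>i. a i \<omega>) r \<longleftrightarrow> r < m \<and> (\<forall>j\<in>{1..r}. a j \<omega> < k j)"
proof -
  have "a j \<omega> = overall_max n (\<lambda>i. a i \<omega>) \<longleftrightarrow> j = m" if "j \<in> {1..r}" for j
    using assms that by (intro eq_overall_max_iff) auto
  then have "continued n k (\<lambda>i. a i \<omega>) r \<longleftrightarrow> (\<forall>j\<in>{1..r}. a j \<omega> < k j \<and> j \<noteq> m)"
    unfolding continued_def by (intro ball_cong) auto
  also have "\<dots> \<longleftrightarrow> r < m \<and> (\<forall>j\<in>{1..r}. a j \<omega> < k j)"
    using assms(2) by (auto simp: not_less)
  finally show ?thesis .
qed

section \<open>The outcomes of a round\<close>

lemma measurable_overall_max [measurable]:
  "(\<lambda>\<omega>. overall_max n (\<lambda>i. a i \<omega>)) \<in> borel_measurable M"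
  unfolding overall_max_def by (intro borel_measurable_Max) auto

lemma measurable_continued:
  assumes "r \<le> n"
  shows "Measurable.pred M (\<lambda>\<omega>. continued n k (\<lambda>i. a i \<omega>) r)"
proof -
  have [measurable]: "a j \<in> borel_measurable M" if "j \<in> {1..r}" for j
    using that assms by (intro measurable_draw) auto
  show ?thesis unfolding continued_def by measurable
qed

lemma sets_continued:
  "r \<le> n \<Longrightarrow> {\<omega> \<in> space M. continued n k (\<lambda>i. a i \<omega>) r} \<in> events"
  using measurable_continued by (simp add: pred_def)

lemma sets_outcomes:
  assumes r: "r \<in> {1..n}"
  shows "{\<omega> \<in> space M. continued n k (\<lambda>i. a i \<omega>) (r - 1) \<and> a r \<omega> \<ge> k r \<and>
      a r \<omega> = overall_max n (\<lambda>i. a i \<omega>)} \<in> events"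
    and "{\<omega> \<in> space M. continued n k (\<lambda>i. a i \<omega>) (r - 1) \<and> a r \<omega> \<ge> k r \<and>
      a r \<omega> \<noteq> overall_max n (\<lambda>i. a i \<omega>)} \<in> events"
    and "{\<omega> \<in> space M. continued n k (\<lambda>i. a i \<omega>) (r - 1) \<and> a r \<omega> < k r \<and>
      a r \<omega> = overall_max n (\<lambda>i. a i \<omega>)} \<in> events"
proof -
  have [measurable]: "a r \<in> borel_measurable M"
    by (rule measurable_draw[OF r])
  have [measurable]: "Measurable.pred M (\<lambda>\<omega>. continued n k (\<lambda>i. a i \<omega>) (r - 1))"
    using r by (intro measurable_continued) auto
  show "{\<omega> \<in> space M. continued n k (\<lambda>i. a i \<omega>) (r - 1) \<and> a r \<omega> \<ge> k r \<and>
      a r \<omega> = overall_max n (\<lambda>i. a i \<omega>)} \<in> events"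
    and "{\<omega> \<in> space M. continued n k (\<lambda>i. a i \<omega>) (r - 1) \<and> a r \<omega> \<ge> k r \<and>
      a r \<omega> \<noteq> overall_max n (\<lambda>i. a i \<omega>)} \<in> events"
    and "{\<omega> \<in> space M. continued n k (\<lambda>i. a i \<omega>) (r - 1) \<and> a r \<omega> < k r \<and>
      a r \<omega> = overall_max n (\<lambda>i. a i \<omega>)} \<in> events"
    by measurable
qed

lemma PC_partition:
  assumes "r \<in> {1..n}"
  shows "PC M a k n (r - 1) = PW M a k n r + PFN M a k n r + PFP M a k n r + PC M a k n r"
proof -
  let ?x = "\<lambda>\<omega> i. a i \<omega>"
  let ?C = "{\<omega> \<in> space M. continued n k (?x \<omega>) (r - 1)}"
  let ?D = "{\<omega> \<in> space M. continued n k (?x \<omega>) r}"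
  let ?W = "{\<omega> \<in> space M. continued n k (?x \<omega>) (r - 1) \<and> a r \<omega> \<ge> k r \<and> a r \<omega> = overall_max n (?x \<omega>)}"
  let ?P = "{\<omega> \<in> space M. continued n k (?x \<omega>) (r - 1) \<and> a r \<omega> \<ge> k r \<and> a r \<omega> \<noteq> overall_max n (?x \<omega>)}"
  let ?N = "{\<omega> \<in> space M. continued n k (?x \<omega>) (r - 1) \<and> a r \<omega> < k r \<and> a r \<omega> = overall_max n (?x \<omega>)}"
  have "{1..r} = insert r {1..r - 1}" using assms by auto
  then have D: "continued n k x r \<longleftrightarrow>
      continued n k x (r - 1) \<and> x r < k r \<and> x r \<noteq> overall_max n x" for x
    by (auto simp: continued_def)
  note W = sets_outcomes(1)[OF assms, of k] and P = sets_outcomes(2)[OF assms, of k]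
    and N = sets_outcomes(3)[OF assms, of k]
  have D': "?D \<in> events" using assms by (intro sets_continued) auto
  have "?C = ?W \<union> ?N \<union> ?P \<union> ?D" by (auto simp: D)
  then have "prob ?C = prob (?W \<union> ?N \<union> ?P \<union> ?D)" by simp
  also have "\<dots> = prob (?W \<union> ?N \<union> ?P) + prob ?D"
    by (intro finite_measure_Union sets.Un W P N D') (auto simp: D)
  also have "prob (?W \<union> ?N \<union> ?P) = prob (?W \<union> ?N) + prob ?P"
    by (intro finite_measure_Union sets.Un W P N) auto
  also have "prob (?W \<union> ?N) = prob ?W + prob ?N"
    by (intro finite_measure_Union W N) auto
  finally show ?thesis by (simp add: PC_def PW_def PFP_def PFN_def)
qed

text \<open>
  The stopping rule ignores whether a rejected draw was the maximum, whereas a game that continues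
  has rejected no maximum. The two notions of winning differ only if a rejected draw ties with
  the accepted one, which is a null event.
\<close>
lemma PW_total_eq_sum: "PW_total M a k n = (\<Sum>r=1..n. PW M a k n r)"
proof -
  let ?W = "\<lambda>r. {\<omega> \<in> space M. continued n k (\<lambda>i. a i \<omega>) (r - 1) \<and> a r \<omega> \<ge> k r \<and>
    a r \<omega> = overall_max n (\<lambda>i. a i \<omega>)}"
  let ?T = "{\<omega> \<in> space M. \<exists>r\<in>{1..n}. stops_at k (\<lambda>i. a i \<omega>) r \<and>
     a r \<omega> = overall_max n (\<lambda>i. a i \<omega>)}"
  have W: "?W r \<in> events" if "r \<in> {1..n}" for r
    by (rule sets_outcomes(1)[OF that])
  have "{\<omega> \<in> space M. stops_at k (\<lambda>i. a i \<omega>) r \<and> a r \<omega> = overall_max n (\<lambda>i. a i \<omega>)} \<in> events"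
    if "r \<in> {1..n}" for r
  proof -
    have [measurable]: "a j \<in> borel_measurable M" if "j \<in> {1..<r}" for j
      using that \<open>r \<in> {1..n}\<close> by (intro measurable_draw) auto
    have [measurable]: "a r \<in> borel_measurable M"
      by (rule measurable_draw[OF that])
    show ?thesis unfolding stops_at_def by measurable
  qed
  then have "(\<Union>r\<in>{1..n}. {\<omega> \<in> space M. stops_at k (\<lambda>i. a i \<omega>) r \<and>
      a r \<omega> = overall_max n (\<lambda>i. a i \<omega>)}) \<in> events"
    by (intro sets.finite_UN) auto
  also have "(\<Union>r\<in>{1..n}. {\<omega> \<in> space M. stops_at k (\<lambda>i. a i \<omega>) r \<and>
      a r \<omega> = overall_max n (\<lambda>i. a i \<omega>)}) = ?T"
    by blast
  finally have T: "?T \<in> events" .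
  have "PW_total M a k n = prob (\<Union>r\<in>{1..n}. ?W r)"
    unfolding PW_total_def
  proof (rule finite_measure_eq_AE[OF _ T])
    show "AE \<omega> in M. \<omega> \<in> ?T \<longleftrightarrow> \<omega> \<in> (\<Union>r\<in>{1..n}. ?W r)"
      using AE_strict_max
    proof (eventually_elim, elim bexE)
      fix \<omega> m assume \<omega>: "\<omega> \<in> strict_max_below (\<lambda>_. 1) m" and m: "m \<in> {1..n}"
      have "(stops_at k (\<lambda>i. a i \<omega>) r \<and> a r \<omega> = overall_max n (\<lambda>i. a i \<omega>)) \<longleftrightarrow>
        (continued n k (\<lambda>i. a i \<omega>) (r - 1) \<and> a r \<omega> \<ge> k r \<and> a r \<omega> = overall_max n (\<lambda>i. a i \<omega>))"
        if r: "r \<in> {1..n}" for r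
      proof -
        have "{1..<r} = {1..r - 1}" using r by auto
        then show ?thesis
          using r continued_iff[OF \<omega> m, of "r - 1" k] eq_overall_max_iff[OF \<omega> m r]
          by (auto simp: stops_at_def not_le)
      qed
      then show "\<omega> \<in> ?T \<longleftrightarrow> \<omega> \<in> (\<Union>r\<in>{1..n}. ?W r)" by auto
    qed
    show "(\<Union>r\<in>{1..n}. ?W r) \<in> events" using W by (intro sets.finite_UN) auto
  qed
  also have "\<dots> = (\<Sum>r=1..n. prob (?W r))"
  proof (intro finite_measure_finite_Union)
    have "\<not> (continued n k x (s - 1) \<and> x r = overall_max n x)" if "1 \<le> r" "r < s" for r s x
      using that by (auto simp: continued_def)
    then have "?W r \<inter> ?W s = {}" if "1 \<le> r" "1 \<le> s" "r \<noteq> s" for r s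
      using that by (cases r s rule: linorder_cases) blast+
    then show "disjoint_family_on ?W {1..n}"
      by (auto simp: disjoint_family_on_def)
  qed (use W in auto)
  finally show ?thesis by (simp add: PW_def)
qed

end

section \<open>Probabilities for non-increasing thresholds\<close>

locale threshold_game = uniform_draws +
  fixes k :: "nat \<Rightarrow> real"
  assumes k_range: "\<And>i. i \<in> {1..n} \<Longrightarrow> k i \<in> {0..1}"
    and k_antimono: "antimono_on {1..n} k"
begin

text \<open>
  The caps that express that the first \<open>r\<close> draws are rejected. As all draws are almost surely below
  \<open>1\<close>, the cap \<open>1\<close> imposes no condition on the later ones.
\<close>
definition caps :: "nat \<Rightarrow> nat \<Rightarrow> real" where
  "caps r j = (if j \<le> r then k j else 1)"

lemma caps_range: "r \<le> n \<Longrightarrow> j \<in> {1..n} \<Longrightarrow> caps r j \<in> {0..1}"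
  using k_range by (auto simp: caps_def)

text \<open>
  Each of the \<open>n - r - 1\<close> later draws other than \<open>m\<close> contributes a factor \<open>x\<close>. The value is the same for
  all \<open>m\<close>: if the first \<open>r\<close> draws are below their thresholds, the maximum is equally likely to be at
  each of the later positions.
\<close>
lemma prob_strict_max_below_caps:
  assumes "r < m" "m \<le> n"
  shows "prob (strict_max_below (caps r) m) =
    integral {0..1} (\<lambda>x. x ^ (n - r - 1) * (\<Prod>j=1..r. min x (k j)))"
proof -
  have split: "{1..n} - {m} = {1..r} \<union> ({r + 1..n} - {m})" using assms by auto
  have "prob (strict_max_below (caps r) m) =
      integral {0..caps r m} (\<lambda>x. \<Prod>j\<in>{1..n} - {m}. min x (caps r j))"
    using assms by (intro prob_strict_max_below caps_range) auto
  also have "caps r m = 1" using assms by (simp add: caps_def)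
  also have "integral {0..1} (\<lambda>x. \<Prod>j\<in>{1..n} - {m}. min x (caps r j)) =
      integral {0..1} (\<lambda>x. x ^ (n - r - 1) * (\<Prod>j=1..r. min x (k j)))"
  proof (intro integral_cong)
    fix x :: real assume "x \<in> {0..1}"
    have "(\<Prod>j\<in>{r + 1..n} - {m}. min x (caps r j)) = (\<Prod>j\<in>{r + 1..n} - {m}. x)"
      using \<open>x \<in> _\<close> by (intro prod.cong) (auto simp: caps_def)
    also have "\<dots> = x ^ (n - r - 1)" using assms by simp
    finally have high: "(\<Prod>j\<in>{r + 1..n} - {m}. min x (caps r j)) = x ^ (n - r - 1)" .
    have "(\<Prod>j\<in>{1..r}. min x (caps r j)) = (\<Prod>j=1..r. min x (k j))"
      by (intro prod.cong) (auto simp: caps_def)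
    then show "(\<Prod>j\<in>{1..n} - {m}. min x (caps r j)) = x ^ (n - r - 1) * (\<Prod>j=1..r. min x (k j))"
      unfolding split by (subst prod.union_disjoint) (simp_all only: high, auto)
  qed
  finally show ?thesis .
qed

lemma all_less_caps_iff:
  assumes "\<omega> \<in> strict_max_below (\<lambda>_. 1) m" "r \<le> n"
  shows "(\<forall>j\<in>{1..n}. a j \<omega> < caps r j) \<longleftrightarrow> (\<forall>j\<in>{1..r}. a j \<omega> < k j)"
  using assms by (auto simp: caps_def strict_max_below_def)

lemma PC_eq_integral:
  assumes "r \<le> n"
  shows "PC M a k n r =
    (real n - real r) * integral {0..1} (\<lambda>x. x ^ (n - r - 1) * (\<Prod>j=1..r. min x (k j)))"
proof -
  have "PC M a k n r = prob (\<Union>m\<in>{r<..n}. strict_max_below (caps r) m)"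
    unfolding PC_def
  proof (rule finite_measure_eq_AE)
    show "AE \<omega> in M. \<omega> \<in> {\<omega> \<in> space M. continued n k (\<lambda>i. a i \<omega>) r} \<longleftrightarrow>
        \<omega> \<in> (\<Union>m\<in>{r<..n}. strict_max_below (caps r) m)"
      using AE_strict_max
    proof (eventually_elim, elim bexE)
      fix \<omega> m assume \<omega>: "\<omega> \<in> strict_max_below (\<lambda>_. 1) m" and m: "m \<in> {1..n}"
      have "\<omega> \<in> space M" using \<omega> by (simp add: strict_max_below_def)
      moreover have "\<omega> \<in> (\<Union>l\<in>{r<..n}. strict_max_below (caps r) l) \<longleftrightarrow>
          r < m \<and> (\<forall>j\<in>{1..r}. a j \<omega> < k j)"
        using in_strict_max_below_iff[OF \<omega> m, of _ "caps r"] all_less_caps_iff[OF \<omega> assms] m by auto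
      ultimately show "\<omega> \<in> {\<omega> \<in> space M. continued n k (\<lambda>i. a i \<omega>) r} \<longleftrightarrow>
          \<omega> \<in> (\<Union>m\<in>{r<..n}. strict_max_below (caps r) m)"
        using continued_iff[OF \<omega> m assms, of k] by simp
    qed
    show "{\<omega> \<in> space M. continued n k (\<lambda>i. a i \<omega>) r} \<in> events"
      using assms by (rule sets_continued)
    show "(\<Union>m\<in>{r<..n}. strict_max_below (caps r) m) \<in> events"
      by (intro sets.finite_UN) auto
  qed
  also have "\<dots> = (\<Sum>m\<in>{r<..n}. prob (strict_max_below (caps r) m))"
    by (intro prob_UN_strict_max_below) auto
  also have "\<dots> = (\<Sum>m\<in>{r<..n}. integral {0..1} (\<lambda>x. x ^ (n - r - 1) * (\<Prod>j=1..r. min x (k j))))"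
    by (intro sum.cong prob_strict_max_below_caps) auto
  finally show ?thesis using assms by (simp add: of_nat_diff)
qed

lemma PC_closed_form:
  assumes "r < n"
  shows "PC M a k n r =
    (\<Prod>j=1..r. k j) - (\<Sum>i=1..r. gcoef i n r * (\<Prod>j=1..r. k j ^ fexp i j n r))"
proof -
  have p: "Suc (n - r - 1) + r = n" "real (Suc (n - r - 1)) = real n - real r" using assms by auto
  have "antimono_on {1..r} k" using assms by (intro monotone_on_subset[OF k_antimono]) auto
  moreover have "k j \<in> {0..1}" if "j \<in> {1..r}" for j using assms that by (intro k_range) auto
  ultimately show ?thesis
    using integral_prod_min[of r k "n - r - 1"] PC_eq_integral[of r] assms unfolding p by simp
qed

text \<open>
  If draw \<open>r\<close> is the maximum and lies below \<open>k r\<close>, then so do all the draws, and since no earlier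
  threshold is smaller than \<open>k r\<close>, the game does reach round \<open>r\<close>. Up to ties a false negative is
  therefore the event with the constant cap \<open>k r\<close>.
\<close>
lemma PFN_closed_form:
  assumes r: "r \<in> {1..n}"
  shows "PFN M a k n r = k r ^ n / real n"
proof -
  let ?E = "{\<omega> \<in> space M. continued n k (\<lambda>i. a i \<omega>) (r - 1) \<and> a r \<omega> < k r \<and>
    a r \<omega> = overall_max n (\<lambda>i. a i \<omega>)}"
  have "PFN M a k n r = prob (strict_max_below (\<lambda>_. k r) r)"
    unfolding PFN_def
  proof (rule finite_measure_eq_AE)
    show "AE \<omega> in M. \<omega> \<in> ?E \<longleftrightarrow> \<omega> \<in> strict_max_below (\<lambda>_. k r) r"
      using AE_strict_max
    proof (eventually_elim, elim bexE)
      fix \<omega> m assume \<omega>: "\<omega> \<in> strict_max_below (\<lambda>_. 1) m" and m: "m \<in> {1..n}"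
      have sp: "\<omega> \<in> space M" using \<omega> by (simp add: strict_max_below_def)
      have le: "a j \<omega> \<le> a m \<omega>" if "j \<in> {1..n}" for j
        using \<omega> that by (cases "j = m") (auto simp: strict_max_below_def intro: less_imp_le)
      have below: "a j \<omega> < k j" if "a m \<omega> < k r" "j \<in> {1..r - 1}" for j
      proof -
        have "k r \<le> k j" using k_antimono r that by (auto simp: monotone_on_def)
        moreover have "j \<in> {1..n}" using that r by auto
        ultimately show ?thesis using le[of j] that by linarith
      qed
      have "\<omega> \<in> strict_max_below (\<lambda>_. k r) r \<longleftrightarrow> r = m \<and> a m \<omega> < k r"
        unfolding in_strict_max_below_iff[OF \<omega> m r, of "\<lambda>_. k r"]
        using le m by (meson le_less_trans)
      moreover have "\<omega> \<in> ?E \<longleftrightarrow> r = m \<and> a m \<omega> < k r"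
        using continued_iff[OF \<omega> m, of "r - 1" k] eq_overall_max_iff[OF \<omega> m r] sp below r by auto
      ultimately show "\<omega> \<in> ?E \<longleftrightarrow> \<omega> \<in> strict_max_below (\<lambda>_. k r) r" by simp
    qed
    show "?E \<in> events" by (rule sets_outcomes(3)[OF r])
  qed (use r in measurable)
  then show ?thesis using prob_strict_max_below_const[OF r k_range[OF r]] by simp
qed

text \<open>
  Together, winning and missing the maximum in round \<open>r\<close> say that round \<open>r\<close> is reached and holds the
  maximum; this is one of the \<open>n - r + 1\<close> equally likely positions that make up \<open>PC(n, r - 1)\<close>.
\<close>
lemma PW_plus_PFN:
  assumes r: "r \<in> {1..n}"
  shows "PW M a k n r + PFN M a k n r = PC M a k n (r - 1) / (real n - real r + 1)"
proof -
  have r1: "r - 1 \<le> n" using r by auto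
  let ?W = "{\<omega> \<in> space M. continued n k (\<lambda>i. a i \<omega>) (r - 1) \<and> a r \<omega> \<ge> k r \<and>
    a r \<omega> = overall_max n (\<lambda>i. a i \<omega>)}"
  let ?N = "{\<omega> \<in> space M. continued n k (\<lambda>i. a i \<omega>) (r - 1) \<and> a r \<omega> < k r \<and>
    a r \<omega> = overall_max n (\<lambda>i. a i \<omega>)}"
  note W = sets_outcomes(1)[OF r, of k] and N = sets_outcomes(3)[OF r, of k]
  have "PW M a k n r + PFN M a k n r = prob (?W \<union> ?N)"
    unfolding PW_def PFN_def by (intro finite_measure_Union[symmetric] W N) auto
  also have "\<dots> = prob (strict_max_below (caps (r - 1)) r)"
  proof (rule finite_measure_eq_AE)
    show "AE \<omega> in M. \<omega> \<in> ?W \<union> ?N \<longleftrightarrow> \<omega> \<in> strict_max_below (caps (r - 1)) r"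
      using AE_strict_max
    proof (eventually_elim, elim bexE)
      fix \<omega> m assume \<omega>: "\<omega> \<in> strict_max_below (\<lambda>_. 1) m" and m: "m \<in> {1..n}"
      have sp: "\<omega> \<in> space M" using \<omega> by (simp add: strict_max_below_def)
      have "\<omega> \<in> ?W \<union> ?N \<longleftrightarrow> r = m \<and> (\<forall>j\<in>{1..r - 1}. a j \<omega> < k j)"
        using continued_iff[OF \<omega> m r1, of k] eq_overall_max_iff[OF \<omega> m r] sp r by auto
      then show "\<omega> \<in> ?W \<union> ?N \<longleftrightarrow> \<omega> \<in> strict_max_below (caps (r - 1)) r"
        using in_strict_max_below_iff[OF \<omega> m r, of "caps (r - 1)"] all_less_caps_iff[OF \<omega> r1] by simp
    qed
  qed (use r W N in \<open>auto intro: sets_strict_max_below\<close>)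
  also have "\<dots> = integral {0..1} (\<lambda>x. x ^ (n - (r - 1) - 1) * (\<Prod>j=1..r - 1. min x (k j)))"
    using r by (intro prob_strict_max_below_caps) auto
  also have "\<dots> = PC M a k n (r - 1) / (real n - real r + 1)"
  proof -
    have diff: "real n - real (r - 1) = real n - real r + 1"
      using r by auto
    have "real n - real r + 1 \<noteq> 0" using r by auto
    then show ?thesis
      unfolding PC_eq_integral[OF r1] diff by (rule nonzero_mult_div_cancel_left[symmetric])
  qed
  finally show ?thesis .
qed

end

theorem mainTheorem1:
  fixes M :: "'a measure" and a :: "nat \<Rightarrow> 'a \<Rightarrow> real" and k :: "nat \<Rightarrow> real" and n :: nat
  assumes "prob_space M"
    and "prob_space.indep_vars M (\<lambda>_. borel) a {1..n}"
    and "\<And>i. i \<in> {1..n} \<Longrightarrow> distr M borel (a i) = uniform_measure lborel {0..1}"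
    and "n \<ge> 1"
    and "\<And>i. i \<in> {1..n} \<Longrightarrow> k i \<in> {0..1}"
    and "antimono_on {1..n} k"
    and "k n = 0"
  shows "(\<forall>r\<in>{1..n - 1}. \<forall>i\<in>{1..r}. (\<Sum>j=1..r. fexp i j n r) = n)
    \<and> (\<forall>r\<in>{1..n}. PFN M a k n r = k r ^ n / real n)
    \<and> (\<forall>r\<in>{1..n}. PW M a k n r = PC M a k n (r - 1) / (real n - real r + 1) - PFN M a k n r)
    \<and> (\<forall>r\<in>{1..n}. PFP M a k n r =
          (PC M a k n (r - 1) - (PW M a k n r + PFN M a k n r)) - PC M a k n r)
    \<and> (\<forall>r\<in>{1..n - 1}. PC M a k n r =
          (\<Prod>j=1..r. k j) - (\<Sum>i=1..r. gcoef i n r * (\<Prod>j=1..r. k j ^ fexp i j n r)))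
    \<and> (\<forall>r\<in>{1..n}. PW M a k n r =
          1 / (real n - real r + 1) *
            ((\<Prod>j=1..r - 1. k j) -
             (\<Sum>i=1..r - 1. gcoef i n (r - 1) * (\<Prod>j=1..r - 1. k j ^ fexp i j n (r - 1))))
          - k r ^ n / real n)
    \<and> PW_total M a k n = (\<Sum>r=1..n. PW M a k n r)"
proof -
  interpret threshold_game M a n k
    using assms by (intro threshold_game.intro uniform_draws.intro uniform_draws_axioms.intro
      threshold_game_axioms.intro) auto
  have PW: "PW M a k n r = PC M a k n (r - 1) / (real n - real r + 1) - PFN M a k n r"
    if "r \<in> {1..n}" for r
    using PW_plus_PFN[OF that] by simp
  show ?thesis
  proof (intro conjI ballI)
    fix r assume r: "r \<in> {1..n}"
    show "PFN M a k n r = k r ^ n / real n"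
      by (rule PFN_closed_form[OF r])
    show "PW M a k n r = PC M a k n (r - 1) / (real n - real r + 1) - PFN M a k n r"
      by (rule PW[OF r])
    show "PFP M a k n r =
        (PC M a k n (r - 1) - (PW M a k n r + PFN M a k n r)) - PC M a k n r"
      using PC_partition[OF r, of k] by simp
    have "r - 1 < n" using r by auto
    show "PW M a k n r =
          1 / (real n - real r + 1) *
            ((\<Prod>j=1..r - 1. k j) -
             (\<Sum>i=1..r - 1. gcoef i n (r - 1) * (\<Prod>j=1..r - 1. k j ^ fexp i j n (r - 1))))
          - k r ^ n / real n"
      unfolding PW[OF r] PFN_closed_form[OF r] PC_closed_form[OF \<open>r - 1 < n\<close>] by simp
  next
    fix r assume "r \<in> {1..n - 1}"
    then show "PC M a k n r =
        (\<Prod>j=1..r. k j) - (\<Sum>i=1..r. gcoef i n r * (\<Prod>j=1..r. k j ^ fexp i j n r))"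
      by (intro PC_closed_form) auto
  next
    fix r i assume "r \<in> {1..n - 1}" "i \<in> {1..r}"
    then show "(\<Sum>j=1..r. fexp i j n r) = n" by (intro sum_fexp) auto
  next
    show "PW_total M a k n = (\<Sum>r=1..n. PW M a k n r)" by (rule PW_total_eq_sum)
  qed
qed

end
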